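(* Let $\gamma \geq 0$ be an integer and $\mathcal{M}$ be a unital $\gamma$-multiprojection algebra of height $h$, with unit $\mathbf{1}$ and endomorphisms $\pi_a$, $a \in [\gamma]$. Let $\mathrm{M}(\mathcal{M})$ be the associated $\gamma$-pluriassociative algebra. Then (i) for any $a \in [h]$, $\mathbf{1}$ is an $a$-bar-unit of $\mathrm{M}(\mathcal{M})$; (ii) for any $a \leq b \in [h]$, $\mathrm{Halo}_a(\mathrm{M}(\mathcal{M}))$ is a subset of $\mathrm{Halo}_b(\mathrm{M}(\mathcal{M}))$; (iii) for any $a \in [h]$, the linear span of $\mathrm{Halo}_a(\mathrm{M}(\mathcal{M}))$ forms an $(h-a+1)$-pluriassociative subalgebra of the $(h-a+1)$-pluriassociative subalgebra of $\mathrm{M}(\mathcal{M})$ induced by $\{a, a+1, \dots, h\}$; (iv) for any $a \in [h]$, $\pi_a$ is the identity map if and only if $\mathbf{1}$ is an $a$-wire-unit of $\mathrm{M}(\mathcal{M})$.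
   Context: The ground field has characteristic zero; $[n]=\{1,\dots,n\}$ and $a \uparrow a' := \max(a,a')$. A $\gamma$-multiassociative algebra is a vector space $\mathcal{M}$ with bilinear operations $\star_a$, $a \in [\gamma]$, such that for all $x,y,z \in \mathcal{M}$, all $b \in [\gamma]$ and all $a, a', a'', a''' \in [\gamma]$ that are $\leq b$: $(x \star_a y) \star_b z = (x \star_b y) \star_{a'} z = x \star_{a''} (y \star_b z) = x \star_b (y \star_{a'''} z)$. An $a$-unit of $\mathcal{M}$ is an element $\mathbf{1}$ with $\mathbf{1} \star_a x = x = x \star_a \mathbf{1}$ for all $x$; a unit is an $a$-unit for some $a \in [\gamma]$. If there is a unit, it is unique, and a $b$-unit is also an $a$-unit for all $a \le b$. The height of $\mathcal{M}$ is $0$ if it has no unit, and otherwise the greatest $h \in [\gamma]$ such that its unit is an $h$-unit. A $\gamma$-multiprojection algebra is a $\gamma$-multiassociative algebra $\mathcal{M}$ endowed with endomorphisms $\pi_a$, $a \in [\gamma]$ (linear maps commuting with all $\star_c$), satisfying $\pi_a \circ \pi_{a'} = \pi_{a \uparrow a'}$ for all $a, a' \in [\gamma]$. Its height is its height as a $\gamma$-multiassociative algebra. It is unital if it has a unit $\mathbf{1}$ (as a $\gamma$-multiassociative algebra) and $\pi_a(\mathbf{1}) = \mathbf{1}$ for all $a \in [h]$, $h$ being its height. A $\gamma$-pluriassociative algebra is a vector space with bilinear operations $\dashv_a, \vdash_a$, $a \in [\gamma]$, such that for all elements $x,y,z$ and all $a, a' \in [\gamma]$: $(x \vdash_{a'}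 y) \dashv_a z = x \vdash_{a'} (y \dashv_a z)$; $(x \dashv_{a\uparrow a'} y) \dashv_a z = x \dashv_a (y \vdash_{a'} z)$; $(x \dashv_{a'} y) \vdash_a z = x \vdash_a (y \vdash_{a \uparrow a'} z)$; $(x \dashv_a y) \dashv_{a\uparrow a'} z = x \dashv_a (y \dashv_{a'} z)$; $(x \vdash_{a'} y) \vdash_a z = x \vdash_{a \uparrow a'} (y \vdash_a z)$. $\mathrm{M}(\mathcal{M})$ is the vector space $\mathcal{M}$ with $x \dashv_a y := x \star_a \pi_a(y)$ and $x \vdash_a y := \pi_a(x) \star_a y$; it is a $\gamma$-pluriassociative algebra. In a $\gamma$-pluriassociative algebra $\mathcal{P}$, an element $e$ is an $a$-bar-unit if $x \dashv_a e = x = e \vdash_a x$ for all $x$, and an $a$-wire-unit if $e \dashv_a x = x = x \vdash_a e$ for all $x$. $\mathrm{Halo}_a(\mathcal{P})$ is the set of $a$-bar-units of $\mathcal{P}$. For $C \subseteq [\gamma]$, the $\#C$-pluriassociative subalgebra of $\mathcal{P}$ induced by $C$ is the vector space $\mathcal{P}$ keeping only the operations $\dashv_c, \vdash_c$ with $c \in C$, renumbered from $1$ to $\#C$ in increasing order. A subalgebra is a subspace stable under all the operations. *)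

theory Defs
  imports Complex_Main
begin

text \<open>
  A family of operations indexed by \<open>[\<gamma>] = {1..\<gamma>}\<close> is represented by a function on all of \<open>nat\<close>;
  its values outside \<open>{1..\<gamma>}\<close> are irrelevant. The underlying vector space is the whole type
  \<open>'m\<close>, over a field \<open>'k\<close> of characteristic zero.
\<close>

definition bilinear_op :: "('k::field \<Rightarrow> 'm::ab_group_add \<Rightarrow> 'm) \<Rightarrow> ('m \<Rightarrow> 'm \<Rightarrow> 'm) \<Rightarrow> bool" where
  "bilinear_op scale f \<longleftrightarrow>
     (\<forall>x. Vector_Spaces.linear scale scale (\<lambda>y. f x y)) \<and>
     (\<forall>y. Vector_Spaces.linear scale scale (\<lambda>x. f x y))"

locale multiassociative_algebra = vector_space scale
  for scale :: "'k::field_char_0 \<Rightarrow> 'm::ab_group_add \<Rightarrow> 'm" +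
  fixes \<gamma> :: nat
    and star :: "nat \<Rightarrow> 'm \<Rightarrow> 'm \<Rightarrow> 'm"
  assumes star_bilinear: "a \<in> {1..\<gamma>} \<Longrightarrow> bilinear_op scale (star a)"
    and star_assoc:
      "\<lbrakk>b \<in> {1..\<gamma>}; a \<in> {1..b}; a' \<in> {1..b}; a'' \<in> {1..b}; a''' \<in> {1..b}\<rbrakk> \<Longrightarrow>
         star b (star a x y) z = star a' (star b x y) z \<and>
         star a' (star b x y) z = star a'' x (star b y z) \<and>
         star a'' x (star b y z) = star b x (star a''' y z)"

definition a_unit :: "(nat \<Rightarrow> 'm \<Rightarrow> 'm \<Rightarrow> 'm) \<Rightarrow> nat \<Rightarrow> 'm \<Rightarrow> bool" where
  "a_unit star a e \<longleftrightarrow> (\<forall>x. star a e x = x \<and> star a x e = x)"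

definition is_unit_of :: "nat \<Rightarrow> (nat \<Rightarrow> 'm \<Rightarrow> 'm \<Rightarrow> 'm) \<Rightarrow> 'm \<Rightarrow> bool" where
  "is_unit_of \<gamma> star e \<longleftrightarrow> (\<exists>a\<in>{1..\<gamma>}. a_unit star a e)"

definition height :: "nat \<Rightarrow> (nat \<Rightarrow> 'm \<Rightarrow> 'm \<Rightarrow> 'm) \<Rightarrow> nat" where
  "height \<gamma> star =
     (if \<exists>e. is_unit_of \<gamma> star e
      then GREATEST h. h \<in> {1..\<gamma>} \<and> a_unit star h (THE e. is_unit_of \<gamma> star e)
      else 0)"

locale multiprojection_algebra = multiassociative_algebra scale \<gamma> star
  for scale :: "'k::field_char_0 \<Rightarrow> 'm::ab_group_add \<Rightarrow> 'm"
    and \<gamma> :: nat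
    and star :: "nat \<Rightarrow> 'm \<Rightarrow> 'm \<Rightarrow> 'm" +
  fixes \<pi> :: "nat \<Rightarrow> 'm \<Rightarrow> 'm"
  assumes proj_linear: "a \<in> {1..\<gamma>} \<Longrightarrow> Vector_Spaces.linear scale scale (\<pi> a)"
    and proj_star:
      "\<lbrakk>a \<in> {1..\<gamma>}; c \<in> {1..\<gamma>}\<rbrakk> \<Longrightarrow> \<pi> a (star c x y) = star c (\<pi> a x) (\<pi> a y)"
    and proj_comp: "\<lbrakk>a \<in> {1..\<gamma>}; a' \<in> {1..\<gamma>}\<rbrakk> \<Longrightarrow> \<pi> a \<circ> \<pi> a' = \<pi> (max a a')"

locale unital_multiprojection_algebra = multiprojection_algebra scale \<gamma> star \<pi>
  for scale :: "'k::field_char_0 \<Rightarrow> 'm::ab_group_add \<Rightarrow> 'm"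
    and \<gamma> :: nat
    and star :: "nat \<Rightarrow> 'm \<Rightarrow> 'm \<Rightarrow> 'm"
    and \<pi> :: "nat \<Rightarrow> 'm \<Rightarrow> 'm" +
  fixes one :: 'm
  assumes unit_one: "is_unit_of \<gamma> star one"
    and proj_one: "a \<in> {1..height \<gamma> star} \<Longrightarrow> \<pi> a one = one"

text \<open>In the following, \<open>dl a\<close> stands for \<open>\<stileturn>\<^sub>a\<close> and \<open>dr a\<close> for \<open>\<turnstile>\<^sub>a\<close>.\<close>

locale pluriassociative_algebra = vector_space scale
  for scale :: "'k::field_char_0 \<Rightarrow> 'm::ab_group_add \<Rightarrow> 'm" +
  fixes \<gamma> :: nat
    and dl dr :: "nat \<Rightarrow> 'm \<Rightarrow> 'm \<Rightarrow> 'm"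
  assumes dl_bilinear: "a \<in> {1..\<gamma>} \<Longrightarrow> bilinear_op scale (dl a)"
    and dr_bilinear: "a \<in> {1..\<gamma>} \<Longrightarrow> bilinear_op scale (dr a)"
    and pluri_1: "\<lbrakk>a \<in> {1..\<gamma>}; a' \<in> {1..\<gamma>}\<rbrakk> \<Longrightarrow> dl a (dr a' x y) z = dr a' x (dl a y z)"
    and pluri_2: "\<lbrakk>a \<in> {1..\<gamma>}; a' \<in> {1..\<gamma>}\<rbrakk> \<Longrightarrow> dl a (dl (max a a') x y) z = dl a x (dr a' y z)"
    and pluri_3: "\<lbrakk>a \<in> {1..\<gamma>}; a' \<in> {1..\<gamma>}\<rbrakk> \<Longrightarrow> dr a (dl a' x y) z = dr a x (dr (max a a') y z)"
    and pluri_4: "\<lbrakk>a \<in> {1..\<gamma>}; a' \<in> {1..\<gamma>}\<rbrakk> \<Longrightarrow> dl (max a a') (dl a x y) z = dl a x (dl a' y z)"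
    and pluri_5: "\<lbrakk>a \<in> {1..\<gamma>}; a' \<in> {1..\<gamma>}\<rbrakk> \<Longrightarrow> dr a (dr a' x y) z = dr (max a a') x (dr a y z)"

locale pluriassociative_subalgebra = pluriassociative_algebra scale \<gamma> dl dr
  for scale :: "'k::field_char_0 \<Rightarrow> 'm::ab_group_add \<Rightarrow> 'm"
    and \<gamma> :: nat
    and dl dr :: "nat \<Rightarrow> 'm \<Rightarrow> 'm \<Rightarrow> 'm" +
  fixes S :: "'m set"
  assumes subspace_S: "subspace S"
    and dl_closed: "\<lbrakk>a \<in> {1..\<gamma>}; x \<in> S; y \<in> S\<rbrakk> \<Longrightarrow> dl a x y \<in> S"
    and dr_closed: "\<lbrakk>a \<in> {1..\<gamma>}; x \<in> S; y \<in> S\<rbrakk> \<Longrightarrow> dr a x y \<in> S"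

text \<open>
  The operations indexed by a finite set \<open>C\<close>, renumbered increasingly by \<open>{1..card C}\<close>
  (list positions start at 0, indices of operations at 1).
\<close>

definition induced_ops :: "nat set \<Rightarrow> (nat \<Rightarrow> 'm \<Rightarrow> 'm \<Rightarrow> 'm) \<Rightarrow> nat \<Rightarrow> 'm \<Rightarrow> 'm \<Rightarrow> 'm" where
  "induced_ops C f i = f (sorted_list_of_set C ! (i - 1))"

definition a_bar_unit ::
  "(nat \<Rightarrow> 'm \<Rightarrow> 'm \<Rightarrow> 'm) \<Rightarrow> (nat \<Rightarrow> 'm \<Rightarrow> 'm \<Rightarrow> 'm) \<Rightarrow> nat \<Rightarrow> 'm \<Rightarrow> bool" where
  "a_bar_unit dl dr a e \<longleftrightarrow> (\<forall>x. dl a x e = x \<and> dr a e x = x)"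

definition a_wire_unit ::
  "(nat \<Rightarrow> 'm \<Rightarrow> 'm \<Rightarrow> 'm) \<Rightarrow> (nat \<Rightarrow> 'm \<Rightarrow> 'm \<Rightarrow> 'm) \<Rightarrow> nat \<Rightarrow> 'm \<Rightarrow> bool" where
  "a_wire_unit dl dr a e \<longleftrightarrow> (\<forall>x. dl a e x = x \<and> dr a x e = x)"

definition Halo ::
  "(nat \<Rightarrow> 'm \<Rightarrow> 'm \<Rightarrow> 'm) \<Rightarrow> (nat \<Rightarrow> 'm \<Rightarrow> 'm \<Rightarrow> 'm) \<Rightarrow> nat \<Rightarrow> 'm set" where
  "Halo dl dr a = {e. a_bar_unit dl dr a e}"

text \<open>The operations of the pluriassociative algebra \<open>M(\<M>)\<close>.\<close>

definition M_left ::
  "(nat \<Rightarrow> 'm \<Rightarrow> 'm \<Rightarrow> 'm) \<Rightarrow> (nat \<Rightarrow> 'm \<Rightarrow> 'm) \<Rightarrow> nat \<Rightarrow> 'm \<Rightarrow> 'm \<Rightarrow> 'm" where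
  "M_left star \<pi> a x y = star a x (\<pi> a y)"

definition M_right ::
  "(nat \<Rightarrow> 'm \<Rightarrow> 'm \<Rightarrow> 'm) \<Rightarrow> (nat \<Rightarrow> 'm \<Rightarrow> 'm) \<Rightarrow> nat \<Rightarrow> 'm \<Rightarrow> 'm \<Rightarrow> 'm" where
  "M_right star \<pi> a x y = star a (\<pi> a x) y"

end

theory Submission
  imports Defs
begin

text \<open>
  If \<open>\<one>\<close> is a \<open>b\<close>-unit, then \<open>x \<star>\<^sub>a y = (x \<star>\<^sub>a y) \<star>\<^sub>b \<one> = (x \<star>\<^sub>b y) \<star>\<^sub>b \<one> = x \<star>\<^sub>b y\<close> for \<open>a \<le> b\<close>, so below
  the height \<open>h\<close> there is a single product with unit \<open>\<one>\<close>. Hence the \<open>a\<close>-bar-units are exactly the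
  elements that \<open>\<pi>\<^sub>a\<close> sends to \<open>\<one>\<close>. For \<open>c\<close> between \<open>a\<close> and \<open>h\<close> the map \<open>\<pi>\<^sub>c\<close> therefore sends the span
  of the halo into the line through \<open>\<one>\<close>, and the operations of index \<open>c\<close> act on that span by scalars.
\<close>

lemma bilinear_op_compose_left:
  assumes "bilinear_op scale f" "Vector_Spaces.linear scale scale p"
  shows "bilinear_op scale (\<lambda>x y. f (p x) y)"
  using Vector_Spaces.linear_compose[OF assms(2), of scale "\<lambda>x. f x y" for y] assms(1)
  by (simp add: bilinear_op_def comp_def)

lemma bilinear_op_compose_right:
  assumes "bilinear_op scale f" "Vector_Spaces.linear scale scale p"
  shows "bilinear_op scale (\<lambda>x y. f x (p y))"
  using Vector_Spaces.linear_compose[OF assms(2), of scale "f x" for x] assms(1)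
  by (simp add: bilinear_op_def comp_def)

text \<open>The increasing enumeration of \<open>C\<close> commutes with \<open>max\<close>, so each
  axiom at renumbered indices \<open>i\<close>, \<open>j\<close> is the same axiom of the ambient
  algebra at the \<open>i\<close>-th and \<open>j\<close>-th elements of \<open>C\<close>.\<close>

lemma (in pluriassociative_algebra) pluriassociative_algebra_induced_ops:
  assumes C: "C \<subseteq> {1..\<gamma>}"
  shows "pluriassociative_algebra scale (card C) (induced_ops C dl) (induced_ops C dr)"
proof -
  define g where "g i = sorted_list_of_set C ! (i - 1)" for i
  have fin: "finite C"
    using C finite_subset by blast
  have g: "g i \<in> {1..\<gamma>}" if "i \<in> {1..card C}" for i
  proof -
    have "g i \<in> set (sorted_list_of_set C)"
      unfolding g_def using that by (intro nth_mem) auto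
    then show ?thesis
      using C fin by auto
  qed
  have mono: "g i \<le> g j" if "i \<le> j" "j \<in> {1..card C}" for i j
    unfolding g_def using that by (intro sorted_nth_mono) auto
  have max: "max (g i) (g j) = g (max i j)" if "i \<in> {1..card C}" "j \<in> {1..card C}" for i j
    using mono[of i j] mono[of j i] that by (cases "i \<le> j") (auto simp: max_def)
  have ops: "induced_ops C f i = f (g i)" for f :: "nat \<Rightarrow> 'b \<Rightarrow> 'b \<Rightarrow> 'b" and i
    unfolding induced_ops_def g_def ..
  show ?thesis
    by (unfold_locales; unfold ops; (simp only: max[symmetric])?;
      (rule dl_bilinear dr_bilinear pluri_1 pluri_2 pluri_3 pluri_4 pluri_5; rule g; assumption))
qed

context multiassociative_algebra
begin

text \<open>A double product depends only on the largest index occurring in it: either bracketing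
  can be brought to the form whose two indices both equal that maximum. This packages
  \<open>star_assoc\<close> in the shape required by the pluriassociative axioms.\<close>

lemma star_star_assoc:
  assumes "a \<in> {1..\<gamma>}" "b \<in> {1..\<gamma>}" "c \<in> {1..\<gamma>}" "d \<in> {1..\<gamma>}" "max a b = max c d"
  shows "star a (star b x y) z = star c x (star d y z)"
proof -
  have left: "star a (star b x y) z = star (max a b) (star (max a b) x y) z"
  proof (cases "a \<le> b")
    case True
    then have "star b (star b x y) z = star a (star b x y) z"
      using assms by (intro star_assoc[THEN conjunct1]) auto
    with True show ?thesis
      by (simp only: max_absorb2)
  next
    case False
    then have "star a (star b x y) z = star a (star a x y) z"
      using assms by (intro star_assoc[THEN conjunct1]) auto
    with False show ?thesis
      by (simp only: max_absorb1 linorder_not_le less_imp_le)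
  qed
  have right: "star c x (star d y z) = star (max c d) (star (max c d) x y) z"
  proof (cases "c \<le> d")
    case True
    then have "star d (star d x y) z = star c x (star d y z)"
      using assms by (intro star_assoc[THEN conjunct2, THEN conjunct1]) auto
    with True show ?thesis
      by (simp only: max_absorb2)
  next
    case False
    then have "star c (star c x y) z = star c x (star c y z)"
      using assms by (intro star_assoc[THEN conjunct2, THEN conjunct1]) auto
    moreover have "star c x (star c y z) = star c x (star d y z)"
      using False assms by (intro star_assoc[THEN conjunct2, THEN conjunct2]) auto
    ultimately show ?thesis
      using False by (simp only: max_absorb1 linorder_not_le less_imp_le)
  qed
  show ?thesis
    unfolding left right assms(5) ..
qed

lemma star_eq_if_a_unit:
  assumes "b \<in> {1..\<gamma>}" "a_unit star b e" "a \<in> {1..b}"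
  shows "star a x y = star b x y"
proof -
  have "star b (star a x y) e = star b (star b x y) e"
    using assms by (intro star_assoc[THEN conjunct1]) auto
  then show ?thesis
    using assms(2) by (simp only: a_unit_def)
qed

lemma a_unit_antimono:
  assumes "b \<in> {1..\<gamma>}" "a_unit star b e" "a \<in> {1..b}"
  shows "a_unit star a e"
  using star_eq_if_a_unit[OF assms] assms(2) unfolding a_unit_def by simp

lemma is_unit_of_unique:
  assumes "is_unit_of \<gamma> star e" "is_unit_of \<gamma> star f"
  shows "e = f"
proof -
  obtain a b where ab: "a \<in> {1..\<gamma>}" "a_unit star a e" "b \<in> {1..\<gamma>}" "a_unit star b f"
    using assms unfolding is_unit_of_def by blast
  \<comment> \<open>Both elements are units at the smaller index, and two units of one product
    coincide.\<close>
  define c where "c = min a b"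
  have "a_unit star c e" "a_unit star c f"
    using a_unit_antimono[of a e c] a_unit_antimono[of b f c] ab unfolding c_def by auto
  then show ?thesis
    unfolding a_unit_def by metis
qed

text \<open>Uniqueness of the unit evaluates the \<open>THE\<close> in \<open>height\<close>; the
  \<open>GREATEST\<close> is attained because the candidate indices are bounded by
  \<open>\<gamma>\<close> and at least one exists.\<close>

lemma height_is_unit:
  assumes "is_unit_of \<gamma> star e"
  shows "height \<gamma> star \<in> {1..\<gamma>} \<and> a_unit star (height \<gamma> star) e"
proof -
  have "(THE u. is_unit_of \<gamma> star u) = e"
    using assms is_unit_of_unique by blast
  then have height: "height \<gamma> star = (GREATEST h. h \<in> {1..\<gamma>} \<and> a_unit star h e)"
    using assms unfolding height_def by auto
  obtain a where "a \<in> {1..\<gamma>} \<and> a_unit star a e"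
    using assms unfolding is_unit_of_def by blast
  then have "(GREATEST h. h \<in> {1..\<gamma>} \<and> a_unit star h e) \<in> {1..\<gamma>} \<and>
      a_unit star (GREATEST h. h \<in> {1..\<gamma>} \<and> a_unit star h e) e"
    by (rule GreatestI_nat[where b = \<gamma>]) simp
  then show ?thesis
    unfolding height .
qed

end

text \<open>Moving the endomorphisms inside the products and merging their composites makes the two
  sides of each axiom opposite bracketings of the same three factors, with equal largest index;
  \<open>star_star_assoc\<close> then applies.\<close>

lemma (in multiprojection_algebra) pluriassociative_algebra_M:
  "pluriassociative_algebra scale \<gamma> (M_left star \<pi>) (M_right star \<pi>)"
proof -
  have comp: "\<pi> a (\<pi> b x) = \<pi> (max a b) x" if "a \<in> {1..\<gamma>}" "b \<in> {1..\<gamma>}" for a b x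
    using proj_comp[OF that] by (metis comp_apply)
  have max_in: "max a b \<in> {1..\<gamma>}" if "a \<in> {1..\<gamma>}" "b \<in> {1..\<gamma>}" for a b
    using that by (auto simp: max_def)
  show ?thesis
  proof (unfold_locales, goal_cases)
    case (1 a)
    show ?case
      unfolding M_left_def[abs_def]
      by (rule bilinear_op_compose_right[OF star_bilinear[OF 1] proj_linear[OF 1]])
  next
    case (2 a)
    show ?case
      unfolding M_right_def[abs_def]
      by (rule bilinear_op_compose_left[OF star_bilinear[OF 2] proj_linear[OF 2]])
  qed (unfold M_left_def M_right_def, simp_all only: comp proj_star max_in,
      (rule star_star_assoc; auto simp: max_def)+)
qed

context unital_multiprojection_algebra
begin

lemma a_unit_one:
  assumes "a \<in> {1..height \<gamma> star}"
  shows "a \<in> {1..\<gamma>}" "a_unit star a one"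
  using height_is_unit[OF unit_one] a_unit_antimono[of "height \<gamma> star" one a] assms by auto

text \<open>Testing the bar-unit law on \<open>one\<close> gives the forward direction; the converse
  is the unit law.\<close>

lemma a_bar_unit_M_iff:
  assumes "a \<in> {1..height \<gamma> star}"
  shows "a_bar_unit (M_left star \<pi>) (M_right star \<pi>) a e \<longleftrightarrow> \<pi> a e = one"
  using a_unit_one(2)[OF assms]
  unfolding a_bar_unit_def M_left_def M_right_def a_unit_def by metis

text \<open>Multiplying by \<open>one\<close> on the wire side leaves \<open>\<pi> a x\<close>, so
  both halves of the wire-unit law read \<open>\<pi> a x = x\<close>.\<close>

lemma a_wire_unit_M_one_iff:
  assumes "a \<in> {1..height \<gamma> star}"
  shows "a_wire_unit (M_left star \<pi>) (M_right star \<pi>) a one \<longleftrightarrow> \<pi> a = id"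
  using a_unit_one(2)[OF assms]
  unfolding a_wire_unit_def M_left_def M_right_def a_unit_def by (auto simp: fun_eq_iff)

lemma Halo_M_mono:
  assumes "b \<in> {1..height \<gamma> star}" "a \<in> {1..b}"
  shows "Halo (M_left star \<pi>) (M_right star \<pi>) a \<subseteq> Halo (M_left star \<pi>) (M_right star \<pi>) b"
proof
  fix e
  have a: "a \<in> {1..height \<gamma> star}"
    using assms by auto
  assume "e \<in> Halo (M_left star \<pi>) (M_right star \<pi>) a"
  then have "\<pi> a e = one"
    using a_bar_unit_M_iff[OF a] by (simp add: Halo_def)
  \<comment> \<open>As \<open>a \<le> b\<close>, the map \<open>\<pi> b\<close> absorbs
    \<open>\<pi> a\<close>, hence \<open>\<pi> b e = \<pi> b one = one\<close>.\<close>
  moreover have "\<pi> b (\<pi> a e) = \<pi> b e"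
    using proj_comp[of b a] a_unit_one(1) a assms by (metis atLeastAtMost_iff comp_apply max.absorb1)
  ultimately show "e \<in> Halo (M_left star \<pi>) (M_right star \<pi>) b"
    using a_bar_unit_M_iff proj_one assms(1) by (simp add: Halo_def)
qed

lemma proj_span_Halo_M:
  assumes "c \<in> {1..height \<gamma> star}" "a \<in> {1..c}"
    and "x \<in> span (Halo (M_left star \<pi>) (M_right star \<pi>) a)"
  obtains k where "\<pi> c x = scale k one"
proof -
  let ?H = "Halo (M_left star \<pi>) (M_right star \<pi>) a"
  interpret p: Vector_Spaces.linear scale scale "\<pi> c"
    using proj_linear a_unit_one(1) assms(1) by blast
  have "\<pi> c ` ?H \<subseteq> {one}"
    using Halo_M_mono[OF assms(1,2)] a_bar_unit_M_iff[OF assms(1)] by (auto simp: Halo_def)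
  then have "\<pi> c ` span ?H \<subseteq> span {one}"
    using span_mono p.span_image by metis
  then show ?thesis
    using assms(3) that by (auto simp: span_singleton)
qed

lemma M_closed_span_Halo:
  assumes c: "c \<in> {1..height \<gamma> star}" and a: "a \<in> {1..c}"
    and x: "x \<in> span (Halo (M_left star \<pi>) (M_right star \<pi>) a)"
    and y: "y \<in> span (Halo (M_left star \<pi>) (M_right star \<pi>) a)"
  shows "M_left star \<pi> c x y \<in> span (Halo (M_left star \<pi>) (M_right star \<pi>) a)"
    and "M_right star \<pi> c x y \<in> span (Halo (M_left star \<pi>) (M_right star \<pi>) a)"
proof -
  have lin: "star c u (scale k v) = scale k (star c u v)"
    "star c (scale k u) v = scale k (star c u v)" for u v k
    using star_bilinear[OF a_unit_one(1)[OF c]] unfolding bilinear_op_def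
    by (meson Vector_Spaces.linear.axioms(3) module_hom.scale linear_iff)+
  obtain k l where kl: "\<pi> c x = scale k one" "\<pi> c y = scale l one"
    using proj_span_Halo_M[OF c a] x y by metis
  show "M_left star \<pi> c x y \<in> span (Halo (M_left star \<pi>) (M_right star \<pi>) a)"
    and "M_right star \<pi> c x y \<in> span (Halo (M_left star \<pi>) (M_right star \<pi>) a)"
    \<comment> \<open>The left operation yields \<open>scale l x\<close> and the right one
      \<open>scale k y\<close>, both in the span.\<close>
    using a_unit_one(2)[OF c] x y
    by (simp_all add: M_left_def M_right_def kl lin a_unit_def span_scale)
qed

lemma span_Halo_M_subalgebra:
  assumes a: "a \<in> {1..height \<gamma> star}"
  shows "pluriassociative_subalgebra scale (height \<gamma> star - a + 1)
    (induced_ops {a..height \<gamma> star} (M_left star \<pi>))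
    (induced_ops {a..height \<gamma> star} (M_right star \<pi>))
    (span (Halo (M_left star \<pi>) (M_right star \<pi>) a))"
proof -
  let ?h = "height \<gamma> star"
  interpret M: pluriassociative_algebra scale \<gamma> "M_left star \<pi>" "M_right star \<pi>"
    by (rule pluriassociative_algebra_M)
  have "{a..?h} \<subseteq> {1..\<gamma>}"
    using a height_is_unit[OF unit_one] by auto
  moreover have "card {a..?h} = ?h - a + 1"
    using a by auto
  ultimately interpret I: pluriassociative_algebra scale "?h - a + 1"
    "induced_ops {a..?h} (M_left star \<pi>)" "induced_ops {a..?h} (M_right star \<pi>)"
    using M.pluriassociative_algebra_induced_ops[of "{a..?h}"] by simp
  \<comment> \<open>Every renumbered operation comes from an index between \<open>a\<close> and the
    height, which is the range covered by \<open>M_closed_span_Halo\<close>.\<close>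
  have index: "sorted_list_of_set {a..?h} ! (i - 1) \<in> {a..?h}" if "i \<in> {1..?h - a + 1}" for i
  proof -
    have "sorted_list_of_set {a..?h} ! (i - 1) \<in> set (sorted_list_of_set {a..?h})"
      using that a by (intro nth_mem) auto
    then show ?thesis
      by simp
  qed
  show ?thesis
  proof
    show "subspace (span (Halo (M_left star \<pi>) (M_right star \<pi>) a))"
      by (rule subspace_span)
  qed (use index a in \<open>force simp: induced_ops_def intro!: M_closed_span_Halo\<close>)+
qed

end

theorem proposition3p3p3:
  fixes scale :: "'k::field_char_0 \<Rightarrow> 'm::ab_group_add \<Rightarrow> 'm"
    and \<gamma> h :: nat
    and star :: "nat \<Rightarrow> 'm \<Rightarrow> 'm \<Rightarrow> 'm"
    and \<pi> :: "nat \<Rightarrow> 'm \<Rightarrow> 'm"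
    and one :: 'm
    and dl dr :: "nat \<Rightarrow> 'm \<Rightarrow> 'm \<Rightarrow> 'm"
  assumes "unital_multiprojection_algebra scale \<gamma> star \<pi> one"
    and "h = height \<gamma> star"
    and "dl = M_left star \<pi>"
    and "dr = M_right star \<pi>"
  shows "(\<forall>a\<in>{1..h}. a_bar_unit dl dr a one) \<and>
         (\<forall>b\<in>{1..h}. \<forall>a\<in>{1..b}. Halo dl dr a \<subseteq> Halo dl dr b) \<and>
         (\<forall>a\<in>{1..h}. pluriassociative_subalgebra scale (h - a + 1)
            (induced_ops {a..h} dl) (induced_ops {a..h} dr)
            (module.span scale (Halo dl dr a))) \<and>
         (\<forall>a\<in>{1..h}. \<pi> a = id \<longleftrightarrow> a_wire_unit dl dr a one)"
proof -
  interpret unital_multiprojection_algebra scale \<gamma> star \<pi> one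
    by (rule assms(1))
  show ?thesis
    unfolding assms(2-4)
    \<comment> \<open>The first claim is the bar-unit criterion applied to \<open>one\<close>, which
      \<open>proj_one\<close> says is fixed.\<close>
    using a_bar_unit_M_iff proj_one Halo_M_mono span_Halo_M_subalgebra a_wire_unit_M_one_iff
    by blast
qed

end
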